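(* The map assigning to each matroid $\mathsf{M}$ its Whitney polynomial $\mathrm{W}_{\mathsf{M}}(t)\in\mathbb{Z}[t]$ is a valuative invariant.
   Context: All matroids have finite ground sets contained in the positive integers. For a matroid $\mathsf{M}$ of rank $k$, the $i$-th Whitney number of the second kind $W_i$ is the number of flats of $\mathsf{M}$ of rank $i$, and the Whitney polynomial is $\mathrm{W}_{\mathsf{M}}(t)=\sum_{i=0}^k W_i\,t^i$. The base polytope of a matroid $\mathsf{M}$ on $E$ with bases $\mathscr{B}$ is $\mathscr{P}(\mathsf{M})=\operatorname{conv}\{\sum_{i\in B}e_i : B\in\mathscr{B}\}\subseteq\mathbb{R}^E$, with indicator function $\mathbf{1}_{\mathscr{P}(\mathsf{M})}:\mathbb{R}^E\to\mathbb{Z}$. A map $f$ from matroids to an abelian group is a valuation if $\sum_{i}a_if(\mathsf{M}_i)=0$ whenever $\mathsf{M}_1,\dots,\mathsf{M}_s$ are matroids on a common ground set and $a_i\in\mathbb{Z}$ satisfy $\sum_i a_i\mathbf{1}_{\mathscr{P}(\mathsf{M}_i)}=0$. (This is known to be equivalent to the inclusion–exclusion property under matroid subdivisions.) A valuative invariant is a valuation with $f(\mathsf{M})=f(\mathsf{N})$ whenever $\mathsf{M}\cong\mathsf{N}$. *)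

theory Defs
  imports "HOL-Analysis.Analysis" "HOL-Analysis.Finite_Function_Topology" "HOL-Computational_Algebra.Polynomial"
begin

record matroid =
  ground :: "nat set"
  bases :: "nat set set"

definition is_matroid :: "matroid \<Rightarrow> bool" where
  "is_matroid M \<longleftrightarrow>
     finite (ground M) \<and> ground M \<subseteq> {0<..} \<and>
     bases M \<noteq> {} \<and> bases M \<subseteq> Pow (ground M) \<and>
     (\<forall>A \<in> bases M. \<forall>B \<in> bases M. \<forall>x \<in> A - B. \<exists>y \<in> B - A. insert y (A - {x}) \<in> bases M)"

definition independent_in :: "matroid \<Rightarrow> nat set \<Rightarrow> bool" where
  "independent_in M I \<longleftrightarrow> (\<exists>B \<in> bases M. I \<subseteq> B)"

definition rank_in :: "matroid \<Rightarrow> nat set \<Rightarrow> nat" where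
  "rank_in M S = Max (card ` {I. I \<subseteq> S \<and> independent_in M I})"

definition matroid_rank :: "matroid \<Rightarrow> nat" where
  "matroid_rank M = rank_in M (ground M)"

definition is_flat :: "matroid \<Rightarrow> nat set \<Rightarrow> bool" where
  "is_flat M F \<longleftrightarrow>
     F \<subseteq> ground M \<and> (\<forall>x \<in> ground M - F. rank_in M F < rank_in M (insert x F))"

definition whitney_second :: "matroid \<Rightarrow> nat \<Rightarrow> nat" where
  "whitney_second M i = card {F. is_flat M F \<and> rank_in M F = i}"

definition whitney_poly :: "matroid \<Rightarrow> int poly" where
  "whitney_poly M = (\<Sum>i\<le>matroid_rank M. monom (int (whitney_second M i)) i)"

definition matroid_iso :: "matroid \<Rightarrow> matroid \<Rightarrow> bool" where
  "matroid_iso M N \<longleftrightarrow>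
     (\<exists>\<phi>. bij_betw \<phi> (ground M) (ground N) \<and> bases N = (\<lambda>B. \<phi> ` B) ` bases M)"

(* The space of real vectors indexed by E, realised inside the finitely supported
   functions on nat as the subspace of vectors supported in E (E is finite). *)
definition coord_space :: "nat set \<Rightarrow> (nat, real) poly_mapping set" where
  "coord_space E = {x. Poly_Mapping.keys x \<subseteq> E}"

definition base_polytope :: "matroid \<Rightarrow> (nat, real) poly_mapping set" where
  "base_polytope M = convex hull ((\<lambda>B. \<Sum>i\<in>B. Poly_Mapping.single i 1) ` bases M)"

(* The integer multiple a x in an arbitrary abelian group; one of the two sums is empty. *)
definition int_multiple :: "int \<Rightarrow> 'a::ab_group_add \<Rightarrow> 'a" where
  "int_multiple a x = (\<Sum>j<nat a. x) - (\<Sum>j<nat (- a). x)"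

lemma int_multiple_ring: "int_multiple a (x :: 'a::ring_1) = of_int a * x"
  by (cases "a \<ge> 0") (auto simp: int_multiple_def)

(* Values of f outside is_matroid are irrelevant. *)
definition matroid_valuation :: "(matroid \<Rightarrow> 'a::ab_group_add) \<Rightarrow> bool" where
  "matroid_valuation f \<longleftrightarrow>
     (\<forall>E (s::nat) (M :: nat \<Rightarrow> matroid) (a :: nat \<Rightarrow> int).
        (\<forall>i\<in>{1..s}. is_matroid (M i) \<and> ground (M i) = E) \<longrightarrow>
        (\<forall>x \<in> coord_space E. (\<Sum>i=1..s. a i * indicator (base_polytope (M i)) x) = 0) \<longrightarrow>
        (\<Sum>i=1..s. int_multiple (a i) (f (M i))) = 0)"

definition valuative_invariant :: "(matroid \<Rightarrow> 'a::ab_group_add) \<Rightarrow> bool" where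
  "valuative_invariant f \<longleftrightarrow>
     matroid_valuation f \<and>
     (\<forall>M N. is_matroid M \<longrightarrow> is_matroid N \<longrightarrow> matroid_iso M N \<longrightarrow> f M = f N)"

end

theory Submission
  imports Defs
begin

(* A flat F of rank r is detected by the base polytope P: with y(F) the sum of the coordinates of y
   in F, the indicator of "F is a flat of rank r" is the difference of the indicators of
     "P contains a y with y(F) >= r and y_e > 0 for all e outside F" and
     "P contains a y with y(F) >= r + 1/2 and y_e > 0 for all e outside F".
   Indeed, if the rank of F exceeds r, moving halfway towards a basis vertex of larger y(F) shows
   that both conditions are equivalent, and if the rank of F equals r, a point of the first kind is
   a convex combination of bases that meet F in r elements and together cover the complement of F.
   Each of the two indicators says that P meets a fixed convex set, an increasing union of closed
   ones, and this is additive because the Euler characteristic of a compact convex set is 1. The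
   additivity of the Euler characteristic is obtained by slicing along one coordinate at a time,
   which reduces it to compact intervals. *)

section \<open>Additivity of the Euler characteristic\<close>

text \<open>A nonempty compact interval is counted by its right endpoint. The weights of the
  intervals ending at \<open>t\<close> add up to the relation at \<open>t\<close> minus the relation
  at a point just to the right of \<open>t\<close>, hence to 0.\<close>

lemma sum_nonempty_intervals_eq_0:
  fixes I :: "'i \<Rightarrow> real set" and a :: "'i \<Rightarrow> int"
  assumes "finite S"
    and I: "\<And>i. i \<in> S \<Longrightarrow> compact (I i) \<and> convex (I i)"
    and zero: "\<And>t. (\<Sum>i\<in>S. a i * of_bool (t \<in> I i)) = 0"
  shows "(\<Sum>i\<in>S. a i * of_bool (I i \<noteq> {})) = 0"
proof -
  define T where "T = {i\<in>S. I i \<noteq> {}}"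
  have "\<exists>l u. I i = {l..u} \<and> l \<le> u" if "i \<in> T" for i
  proof -
    have "connected (I i)" "compact (I i)" "I i \<noteq> {}"
      using I that by (auto simp: T_def convex_connected)
    then obtain l u where "I i = {l..u}"
      by (metis connected_compact_interval_1)
    with \<open>I i \<noteq> {}\<close> show ?thesis by auto
  qed
  then obtain l u where lu: "\<And>i. i \<in> T \<Longrightarrow> I i = {l i..u i} \<and> l i \<le> u i"
    by metis
  have "finite T" using \<open>finite S\<close> by (simp add: T_def)
  have sumT: "(\<Sum>i\<in>S. a i * of_bool (t \<in> I i)) = (\<Sum>i\<in>T. a i * of_bool (t \<in> I i))" for t
    by (rule sum.mono_neutral_right) (use \<open>finite S\<close> in \<open>auto simp: T_def\<close>)
  have endpoint: "(\<Sum>i\<in>{i\<in>T. u i = t}. a i) = 0" for t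
  proof -
    \<comment> \<open>Just to the right of \<open>t\<close>, membership changes only for intervals
      ending at \<open>t\<close>; as \<open>T\<close> is finite, one \<open>s\<close> serves all of
      them.\<close>
    have "eventually (\<lambda>s. \<forall>i\<in>T. s \<in> I i \<longleftrightarrow> t \<in> I i \<and> u i \<noteq> t) (at_right t)"
    proof (rule eventually_ball_finite[OF \<open>finite T\<close>], intro ballI)
      fix i assume "i \<in> T"
      note i = lu[OF this]
      consider "t < l i" | "l i \<le> t" "t < u i" | "u i \<le> t" by linarith
      then show "eventually (\<lambda>s. s \<in> I i \<longleftrightarrow> t \<in> I i \<and> u i \<noteq> t) (at_right t)"
      proof cases
        case 1
        show ?thesis
          using eventually_at_right_real[OF 1] by eventually_elim (use i 1 in auto)
      next
        case 2
        show ?thesis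
          using eventually_at_right_real[OF 2(2)] by eventually_elim (use i 2 in auto)
      next
        case 3
        show ?thesis
          using eventually_at_right_less[of t] by eventually_elim (use i 3 in auto)
      qed
    qed
    then obtain s where s: "\<And>i. i \<in> T \<Longrightarrow> s \<in> I i \<longleftrightarrow> t \<in> I i \<and> u i \<noteq> t"
      using eventually_happens'[OF trivial_limit_at_right_real] by fast
    have "0 = (\<Sum>i\<in>T. a i * of_bool (t \<in> I i)) - (\<Sum>i\<in>T. a i * of_bool (s \<in> I i))"
      using zero[of t] zero[of s] by (simp add: sumT)
    also have "\<dots> = (\<Sum>i\<in>T. if u i = t then a i else 0)"
      unfolding sum_subtractf[symmetric] by (rule sum.cong) (use s lu in auto)
    also have "\<dots> = (\<Sum>i\<in>{i\<in>T. u i = t}. a i)"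
      by (rule sum.inter_filter[OF \<open>finite T\<close>, symmetric])
    finally show ?thesis by simp
  qed
  have "(\<Sum>i\<in>S. a i * of_bool (I i \<noteq> {})) = (\<Sum>i\<in>T. a i)"
    unfolding T_def sum.inter_filter[OF \<open>finite S\<close>] by (rule sum.cong) auto
  \<comment> \<open>Grouping by right endpoint makes every group cancel by
    \<open>endpoint\<close>.\<close>
  also have "\<dots> = (\<Sum>t\<in>u ` T. \<Sum>i\<in>{i\<in>T. u i = t}. a i)"
    by (rule sum.image_gen[OF \<open>finite T\<close>])
  finally show ?thesis by (simp add: endpoint)
qed

text \<open>The functionals \<open>\<phi> e\<close> play the role of coordinates. They have to
  separate points only on \<open>X\<close>, so the surrounding normed space may be infinite
  dimensional. Freeing the coordinates one by one leads from single points to whole sets, and each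
  stage is the interval case.\<close>

lemma sum_nonempty_compact_convex_eq_0:
  fixes K :: "'i \<Rightarrow> 'v::real_normed_vector set" and a :: "'i \<Rightarrow> int"
    and \<phi> :: "'e \<Rightarrow> 'v \<Rightarrow> real"
  assumes "finite S" "finite E"
    and K: "\<And>i. i \<in> S \<Longrightarrow> compact (K i) \<and> convex (K i) \<and> K i \<subseteq> X"
    and lin: "\<And>e. e \<in> E \<Longrightarrow> bounded_linear (\<phi> e)"
    and sep: "\<And>x y. x \<in> X \<Longrightarrow> y \<in> X \<Longrightarrow> (\<And>e. e \<in> E \<Longrightarrow> \<phi> e x = \<phi> e y) \<Longrightarrow> x = y"
    and zero: "\<And>x. x \<in> X \<Longrightarrow> (\<Sum>i\<in>S. a i * of_bool (x \<in> K i)) = 0"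
  shows "(\<Sum>i\<in>S. a i * of_bool (K i \<noteq> {})) = 0"
proof -
  \<comment> \<open>\<open>J\<close> is the set of free coordinates; those in \<open>E - J\<close>
    are fixed to the values \<open>c\<close>. \<open>J = {}\<close> is the pointwise relation and
    \<open>J = E\<close> is the claim.\<close>
  have "(\<Sum>i\<in>S. a i * of_bool (\<exists>x\<in>K i. \<forall>e\<in>E - J. \<phi> e x = c e)) = 0" if "J \<subseteq> E" for J c
    using finite_subset[OF that \<open>finite E\<close>] that
  proof (induction J arbitrary: c rule: finite_induct)
    case empty
    show ?case
    \<comment> \<open>With all coordinates fixed, at most one point of \<open>X\<close> remains, by
      \<open>sep\<close>.\<close>
    proof (cases "\<exists>x\<in>X. \<forall>e\<in>E. \<phi> e x = c e")
      case True
      then obtain x where x: "x \<in> X" "\<forall>e\<in>E. \<phi> e x = c e" by blast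
      have "(\<exists>y\<in>K i. \<forall>e\<in>E - {}. \<phi> e y = c e) \<longleftrightarrow> x \<in> K i" if "i \<in> S" for i
        using sep[OF \<open>x \<in> X\<close>] x K[OF that] by (metis Diff_empty subsetD)
      then show ?thesis
        using zero[OF \<open>x \<in> X\<close>] by simp
    next
      case False
      then show ?thesis
        using K by (intro sum.neutral) (auto simp: subset_iff)
    qed
  next
    case (insert d J)
    \<comment> \<open>The slice of \<open>K i\<close> in which \<open>d\<close> and \<open>J\<close>
      are free. Its image under \<open>\<phi> d\<close> is a compact interval, and this image
      contains \<open>t\<close> exactly when the slice with \<open>d\<close> fixed to
      \<open>t\<close> is nonempty; the induction hypothesis for \<open>c(d := t)\<close> therefore
      supplies the relation between the intervals.\<close>
    define F where "F i = K i \<inter> (\<Inter>e\<in>E - insert d J. {x. \<phi> e x = c e})" for i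
    have "(\<Sum>i\<in>S. a i * of_bool (\<phi> d ` F i \<noteq> {})) = 0"
    proof (rule sum_nonempty_intervals_eq_0[OF \<open>finite S\<close>])
      fix i assume "i \<in> S"
      have "closed (\<Inter>e\<in>E - insert d J. {x. \<phi> e x = c e})"
        by (intro closed_INT ballI closed_Collect_eq continuous_intros
              linear_continuous_on lin) auto
      moreover have "convex (\<Inter>e\<in>E - insert d J. {x. \<phi> e x = c e})"
      proof (intro convex_INT)
        fix e assume "e \<in> E - insert d J"
        then have "linear (\<phi> e)" using lin bounded_linear.linear by auto
        then show "convex {x. \<phi> e x = c e}"
          using convex_linear_vimage[of "\<phi> e" "{c e}"] by (simp add: vimage_def)
      qed
      ultimately have "compact (F i)" "convex (F i)"
        using K[OF \<open>i \<in> S\<close>] by (auto simp: F_def intro: compact_Int_closed convex_Int)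
      then show "compact (\<phi> d ` F i) \<and> convex (\<phi> d ` F i)"
        using insert.prems lin[of d]
        by (auto intro!: compact_continuous_image linear_continuous_on convex_linear_image
              bounded_linear.linear)
    next
      fix t
      have "t \<in> \<phi> d ` F i \<longleftrightarrow> (\<exists>x\<in>K i. \<forall>e\<in>E - J. \<phi> e x = (c(d := t)) e)" for i
      proof -
        have "E - J = insert d (E - insert d J)"
          using insert.prems \<open>d \<notin> J\<close> by auto
        then show ?thesis by (auto simp: F_def)
      qed
      then show "(\<Sum>i\<in>S. a i * of_bool (t \<in> \<phi> d ` F i)) = 0"
        using insert.IH[of "c(d := t)"] insert.prems by simp
    qed
    moreover have "\<phi> d ` F i \<noteq> {} \<longleftrightarrow> (\<exists>x\<in>K i. \<forall>e\<in>E - insert d J. \<phi> e x = c e)" for i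
      by (auto simp: F_def)
    ultimately show ?case by simp
  qed
  from this[of E] show ?thesis by (simp add: ex_in_conv)
qed

text \<open>A union of closed sets need not be closed, so \<open>K i\<close> cut with it may fail to
  be compact. As the union is increasing and \<open>S\<close> is finite, a single \<open>C n\<close>
  already meets every \<open>K i\<close> that the union meets.\<close>

lemma sum_meets_Union_eq_0:
  fixes K :: "'i \<Rightarrow> 'v::real_normed_vector set" and a :: "'i \<Rightarrow> int"
    and \<phi> :: "'e \<Rightarrow> 'v \<Rightarrow> real" and C :: "nat \<Rightarrow> 'v set"
  assumes "finite S" "finite E"
    and K: "\<And>i. i \<in> S \<Longrightarrow> compact (K i) \<and> convex (K i) \<and> K i \<subseteq> X"
    and lin: "\<And>e. e \<in> E \<Longrightarrow> bounded_linear (\<phi> e)"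
    and sep: "\<And>x y. x \<in> X \<Longrightarrow> y \<in> X \<Longrightarrow> (\<And>e. e \<in> E \<Longrightarrow> \<phi> e x = \<phi> e y) \<Longrightarrow> x = y"
    and zero: "\<And>x. x \<in> X \<Longrightarrow> (\<Sum>i\<in>S. a i * of_bool (x \<in> K i)) = 0"
    and C: "\<And>n. closed (C n) \<and> convex (C n)" "mono C"
  shows "(\<Sum>i\<in>S. a i * of_bool (K i \<inter> (\<Union>n. C n) \<noteq> {})) = 0"
proof -
  have "eventually (\<lambda>n. \<forall>i\<in>S. K i \<inter> (\<Union>n. C n) \<noteq> {} \<longleftrightarrow> K i \<inter> C n \<noteq> {}) sequentially"
  proof (rule eventually_ball_finite[OF \<open>finite S\<close>], intro ballI)
    fix i
    show "eventually (\<lambda>n. K i \<inter> (\<Union>n. C n) \<noteq> {} \<longleftrightarrow> K i \<inter> C n \<noteq> {}) sequentially"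
    proof (cases "K i \<inter> (\<Union>n. C n) = {}")
      case False
      then obtain x m where "x \<in> K i" "x \<in> C m" by blast
      then show ?thesis
        using monoD[OF \<open>mono C\<close>] by (fastforce intro: eventually_sequentiallyI[of m])
    qed (auto intro!: always_eventually)
  qed
  then obtain n where n: "\<And>i. i \<in> S \<Longrightarrow> K i \<inter> (\<Union>n. C n) \<noteq> {} \<longleftrightarrow> K i \<inter> C n \<noteq> {}"
    using eventually_happens'[OF sequentially_bot] by fast
  have "(\<Sum>i\<in>S. a i * of_bool (K i \<inter> C n \<noteq> {})) = 0"
  proof (rule sum_nonempty_compact_convex_eq_0[OF \<open>finite S\<close> \<open>finite E\<close> _ lin sep])
    show "compact (K i \<inter> C n) \<and> convex (K i \<inter> C n) \<and> K i \<inter> C n \<subseteq> X" if "i \<in> S" for i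
      using K[OF that] C(1)[of n] by (auto intro: compact_Int_closed convex_Int)
    \<comment> \<open>Cutting all sets with the same \<open>C n\<close> multiplies the relation by
      the indicator of \<open>C n\<close>.\<close>
    show "(\<Sum>i\<in>S. a i * of_bool (x \<in> K i \<inter> C n)) = 0" if "x \<in> X" for x
      using zero[OF that] by (cases "x \<in> C n") auto
  qed
  then show ?thesis using n by simp
qed

section \<open>Base polytopes\<close>

lemma lookup_scaleR: "Poly_Mapping.lookup (c *\<^sub>R x) i = c *\<^sub>R Poly_Mapping.lookup x i"
proof -
  have "finite {i. c *\<^sub>R Poly_Mapping.lookup x i \<noteq> 0}"
    by (rule finite_subset[OF _ finite_lookup[of x]]) auto
  then show ?thesis by (simp add: scaleR_poly_mapping_def)
qed

lemma bounded_linear_lookup: "bounded_linear (\<lambda>x. Poly_Mapping.lookup x i)"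
proof (rule bounded_linear_intro[where K = 1])
  fix x :: "'a \<Rightarrow>\<^sub>0 'b"
  show "norm (Poly_Mapping.lookup x i) \<le> norm x * 1"
  proof (cases "i \<in> Poly_Mapping.keys x")
    case True
    then show ?thesis
      \<comment> \<open>The norm is a sum over the support, and a single coordinate contributes one
        summand.\<close>
      by (auto simp: norm_poly_mapping_def dist_poly_mapping_def intro!: member_le_sum)
  qed (simp add: in_keys_iff)
qed (simp_all add: lookup_add lookup_scaleR)

definition basis_vector :: "nat set \<Rightarrow> (nat, real) poly_mapping" where
  "basis_vector B = (\<Sum>i\<in>B. Poly_Mapping.single i 1)"

lemma lookup_basis_vector:
  "finite B \<Longrightarrow> Poly_Mapping.lookup (basis_vector B) i = of_bool (i \<in> B)"
  by (simp add: basis_vector_def lookup_sum lookup_single when_def)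

lemma sum_lookup_basis_vector:
  assumes "finite B" "finite F"
  shows "(\<Sum>i\<in>F. Poly_Mapping.lookup (basis_vector B) i) = card (B \<inter> F)"
  using assms by (simp add: lookup_basis_vector Int_commute Int_def flip: sum.inter_filter)

lemma base_polytope_eq: "base_polytope M = convex hull (basis_vector ` bases M)"
  by (simp add: base_polytope_def basis_vector_def)

lemma is_matroidD:
  assumes "is_matroid M"
  shows "finite (ground M)" "bases M \<noteq> {}" "finite (bases M)"
    "\<And>B. B \<in> bases M \<Longrightarrow> B \<subseteq> ground M" "\<And>B. B \<in> bases M \<Longrightarrow> finite B"
  using assms unfolding is_matroid_def
  by (auto intro: finite_subset[of "bases M" "Pow (ground M)"] finite_subset[of _ "ground M"])

lemma base_polytope_compact_convex:
  assumes "is_matroid M"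
  shows "compact (base_polytope M)" "convex (base_polytope M)"
    "base_polytope M \<subseteq> coord_space (ground M)"
proof -
  show "compact (base_polytope M)" "convex (base_polytope M)"
    using is_matroidD(3)[OF assms]
    by (simp_all add: base_polytope_eq finite_imp_compact_convex_hull)
  have "coord_space (ground M) = (\<Inter>i\<in>- ground M. {x. Poly_Mapping.lookup x i = 0})"
    by (auto simp: coord_space_def in_keys_iff)
  moreover have "convex {x :: nat \<Rightarrow>\<^sub>0 real. Poly_Mapping.lookup x i = 0}" for i
    using convex_linear_vimage[OF bounded_linear.linear[OF bounded_linear_lookup], of "{0}" i]
    by (simp add: vimage_def)
  ultimately have "convex (coord_space (ground M))"
    by (simp add: convex_INT)
  moreover have "basis_vector ` bases M \<subseteq> coord_space (ground M)"
    using is_matroidD(4,5)[OF assms]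
    by (fastforce simp: coord_space_def in_keys_iff lookup_basis_vector)
  ultimately show "base_polytope M \<subseteq> coord_space (ground M)"
    by (simp add: base_polytope_eq hull_minimal)
qed

text \<open>The weights are indexed by bases instead of vertices, which makes the coordinate sum
  over \<open>F\<close> a weighted average of the numbers
  \<open>card (B \<inter> F)\<close>.\<close>

lemma base_polytopeE:
  assumes "is_matroid M" "finite F" "y \<in> base_polytope M"
  obtains w where "\<And>B. B \<in> bases M \<Longrightarrow> 0 \<le> w B" "sum w (bases M) = 1"
    "\<And>i. Poly_Mapping.lookup y i = (\<Sum>B\<in>bases M. w B * of_bool (i \<in> B))"
    "(\<Sum>i\<in>F. Poly_Mapping.lookup y i) = (\<Sum>B\<in>bases M. w B * card (B \<inter> F))"
proof -
  note M = is_matroidD[OF assms(1)]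
  \<comment> \<open>Distinct bases give distinct vertices, so weights on vertices can be reindexed
    by bases.\<close>
  have inj: "inj_on basis_vector (bases M)"
  proof (rule inj_onI)
    fix A B assume "A \<in> bases M" "B \<in> bases M" "basis_vector A = basis_vector B"
    then have "of_bool (i \<in> A) = (of_bool (i \<in> B) :: real)" for i
      using M(5) by (metis lookup_basis_vector)
    then show "A = B" by (auto simp: of_bool_eq_iff)
  qed
  obtain v where v: "\<And>x. x \<in> basis_vector ` bases M \<Longrightarrow> 0 \<le> v x"
      "sum v (basis_vector ` bases M) = 1" "(\<Sum>x\<in>basis_vector ` bases M. v x *\<^sub>R x) = y"
    using assms(3) M(3) by (auto simp: base_polytope_eq convex_hull_finite)
  define w where "w B = v (basis_vector B)" for B
  have w: "\<And>B. B \<in> bases M \<Longrightarrow> 0 \<le> w B" "sum w (bases M) = 1"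
    and y: "y = (\<Sum>B\<in>bases M. w B *\<^sub>R basis_vector B)"
    using v by (auto simp: w_def sum.reindex[OF inj])
  have lookup: "Poly_Mapping.lookup y i = (\<Sum>B\<in>bases M. w B * of_bool (i \<in> B))" for i
    using M(5) by (simp add: y lookup_sum lookup_scaleR lookup_basis_vector)
  have "(\<Sum>i\<in>F. Poly_Mapping.lookup y i) = (\<Sum>B\<in>bases M. w B * card (B \<inter> F))"
  proof -
    have "(\<Sum>i\<in>F. Poly_Mapping.lookup y i) =
        (\<Sum>B\<in>bases M. w B * (\<Sum>i\<in>F. Poly_Mapping.lookup (basis_vector B) i))"
      unfolding y lookup_sum lookup_scaleR sum_distrib_left by (subst sum.swap) simp
    then show ?thesis
      using M(5) \<open>finite F\<close> by (simp add: sum_lookup_basis_vector)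
  qed
  with w lookup show ?thesis by (rule that)
qed

section \<open>Rank and flats\<close>

text \<open>Independent subsets of \<open>F\<close> are the subsets of the sets
  \<open>B \<inter> F\<close>, and the largest of these are the \<open>B \<inter> F\<close>
  themselves. Thus the rank of \<open>F\<close> is the maximum over the vertices of the base
  polytope of the linear functional summing the coordinates in \<open>F\<close>.\<close>

lemma rank_in_eq_Max_card_Int:
  assumes "is_matroid M"
  shows "rank_in M F = Max ((\<lambda>B. card (B \<inter> F)) ` bases M)"
proof -
  note M = is_matroidD[OF assms]
  have *: "{I. I \<subseteq> F \<and> independent_in M I} = (\<Union>B\<in>bases M. Pow (B \<inter> F))"
    by (auto simp: independent_in_def)
  have "finite (\<Union>B\<in>bases M. Pow (B \<inter> F))"
    using M by auto
  moreover have "card I \<le> card (B \<inter> F)" if "B \<in> bases M" "I \<subseteq> B \<inter> F" for I B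
    using that M by (auto intro: card_mono)
  ultimately show ?thesis
    using M(3) unfolding rank_in_def * by (intro Max_eq_if) auto
qed

lemma card_Int_le_rank_in:
  assumes "is_matroid M" "B \<in> bases M"
  shows "card (B \<inter> F) \<le> rank_in M F"
  using assms is_matroidD(3) by (auto simp: rank_in_eq_Max_card_Int)

lemma rank_in_attained:
  assumes "is_matroid M"
  obtains B where "B \<in> bases M" "card (B \<inter> F) = rank_in M F"
proof -
  have "rank_in M F \<in> (\<lambda>B. card (B \<inter> F)) ` bases M"
    unfolding rank_in_eq_Max_card_Int[OF assms]
    using is_matroidD(2,3)[OF assms] by (intro Max_in) auto
  then show ?thesis using that by auto
qed

lemma rank_in_le_matroid_rank:
  assumes "is_matroid M"
  shows "rank_in M F \<le> matroid_rank M"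
proof -
  note M = is_matroidD[OF assms]
  obtain B where B: "B \<in> bases M" "card (B \<inter> F) = rank_in M F"
    using rank_in_attained[OF assms] .
  have "card (B \<inter> F) \<le> card (B \<inter> ground M)"
    using M(4,5)[OF B(1)] by (intro card_mono) auto
  then show ?thesis
    using card_Int_le_rank_in[OF assms B(1), of "ground M"] B(2) by (simp add: matroid_rank_def)
qed

section \<open>Detecting flats by points of the base polytope\<close>

definition positive_region :: "nat set \<Rightarrow> nat set \<Rightarrow> real \<Rightarrow> (nat, real) poly_mapping set" where
  "positive_region E F c =
     {y. c \<le> (\<Sum>i\<in>F. Poly_Mapping.lookup y i) \<and> (\<forall>e\<in>E - F. 0 < Poly_Mapping.lookup y e)}"

text \<open>The coordinate sum over \<open>F\<close> is a weighted average of numbers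
  \<open>card (B \<inter> F)\<close>, none of which exceeds the rank of \<open>F\<close>.\<close>

lemma rank_in_ge_if_meets_positive_region:
  assumes M: "is_matroid M" and "finite F"
    and "base_polytope M \<inter> positive_region E F c \<noteq> {}"
  shows "c \<le> rank_in M F"
proof -
  obtain y where y: "y \<in> base_polytope M" "c \<le> (\<Sum>i\<in>F. Poly_Mapping.lookup y i)"
    using assms(3) by (auto simp: positive_region_def)
  obtain w :: "nat set \<Rightarrow> real" where w: "\<And>B. B \<in> bases M \<Longrightarrow> 0 \<le> w B" "sum w (bases M) = 1"
    and sumF: "(\<Sum>i\<in>F. Poly_Mapping.lookup y i) = (\<Sum>B\<in>bases M. w B * card (B \<inter> F))"
    by (rule base_polytopeE[OF M \<open>finite F\<close> y(1)]) blast
  have "(\<Sum>B\<in>bases M. w B * card (B \<inter> F)) \<le> (\<Sum>B\<in>bases M. w B * rank_in M F)"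
    using w card_Int_le_rank_in[OF M] by (intro sum_mono mult_left_mono) auto
  also have "\<dots> = rank_in M F"
    using w by (simp flip: sum_distrib_right)
  finally show ?thesis using y sumF by simp
qed

text \<open>Both sides say that the bases meeting \<open>F\<close> in as many elements as possible
  cover the complement of \<open>F\<close>.\<close>

lemma is_flat_iff_meets_positive_region:
  assumes M: "is_matroid M" and F: "F \<subseteq> ground M"
  shows "is_flat M F \<longleftrightarrow>
    base_polytope M \<inter> positive_region (ground M) F (rank_in M F) \<noteq> {}"
proof
  note finF = finite_subset[OF F is_matroidD(1)[OF M]]
  assume flat: "is_flat M F"
  define \<B> where "\<B> = {B \<in> bases M. card (B \<inter> F) = rank_in M F}"
  have "finite \<B>" using is_matroidD(3)[OF M] by (simp add: \<B>_def)
  have "\<B> \<noteq> {}" using rank_in_attained[OF M, of F] by (auto simp: \<B>_def)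
  then have "card \<B> > 0" using \<open>finite \<B>\<close> by (simp add: card_gt_0_iff)
  have fin: "finite B" if "B \<in> \<B>" for B
    using that is_matroidD(5)[OF M] by (simp add: \<B>_def)
  \<comment> \<open>Take a base attaining the rank of \<open>insert e F\<close>. Without
    \<open>e\<close> it would meet \<open>F\<close> in more than \<open>rank_in M F\<close>
    elements; hence it contains \<open>e\<close>, and dropping \<open>e\<close> leaves exactly
    \<open>rank_in M F\<close> elements in \<open>F\<close>.\<close>
  have cover: "\<exists>B\<in>\<B>. e \<in> B" if "e \<in> ground M - F" for e
  proof -
    obtain B where B: "B \<in> bases M" "card (B \<inter> insert e F) = rank_in M (insert e F)"
      using rank_in_attained[OF M] .
    have less: "rank_in M F < rank_in M (insert e F)"
      using flat that by (auto simp: is_flat_def)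
    have "e \<in> B"
      using less B card_Int_le_rank_in[OF M B(1), of F] by (metis Int_insert_right leD)
    moreover have "card (B \<inter> insert e F) \<le> Suc (card (B \<inter> F))"
      using \<open>e \<in> B\<close> finF by (simp add: card_insert_le_m1 card_insert_if)
    ultimately have "B \<in> \<B>"
      using less B card_Int_le_rank_in[OF M B(1), of F] by (simp add: \<B>_def)
    with \<open>e \<in> B\<close> show ?thesis by blast
  qed
  \<comment> \<open>The barycentre gives every base in \<open>\<B>\<close> positive weight, so each
    covered element gets a positive coordinate.\<close>
  define y where "y = (\<Sum>B\<in>\<B>. (1 / card \<B>) *\<^sub>R basis_vector B)"
  have "basis_vector B \<in> base_polytope M" if "B \<in> \<B>" for B
    using that by (auto simp: \<B>_def base_polytope_eq intro: hull_inc)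
  then have "y \<in> base_polytope M"
    unfolding y_def
    using \<open>finite \<B>\<close> \<open>\<B> \<noteq> {}\<close> base_polytope_compact_convex(2)[OF M]
    by (intro convex_sum) auto
  moreover have "(\<Sum>i\<in>F. Poly_Mapping.lookup y i) = rank_in M F"
  proof -
    have "(\<Sum>i\<in>F. Poly_Mapping.lookup y i) =
        (\<Sum>B\<in>\<B>. (1 / card \<B>) * (\<Sum>i\<in>F. Poly_Mapping.lookup (basis_vector B) i))"
      unfolding y_def lookup_sum lookup_scaleR sum_distrib_left by (subst sum.swap) simp
    also have "\<dots> = (\<Sum>B\<in>\<B>. (1 / card \<B>) * rank_in M F)"
    proof (rule sum.cong[OF refl])
      fix B assume "B \<in> \<B>"
      then have "card (B \<inter> F) = rank_in M F" by (simp add: \<B>_def)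
      then show "(1 / card \<B>) * (\<Sum>i\<in>F. Poly_Mapping.lookup (basis_vector B) i) =
          (1 / card \<B>) * rank_in M F"
        using fin[OF \<open>B \<in> \<B>\<close>] finF by (simp add: sum_lookup_basis_vector)
    qed
    finally show ?thesis using \<open>card \<B> > 0\<close> by simp
  qed
  moreover have "0 < Poly_Mapping.lookup y e" if e: "e \<in> ground M - F" for e
  proof -
    obtain B where "B \<in> \<B>" "e \<in> B" using cover[OF e] by blast
    have "Poly_Mapping.lookup y e = (\<Sum>B\<in>\<B>. (1 / card \<B>) * of_bool (e \<in> B))"
      unfolding y_def lookup_sum lookup_scaleR
      by (rule sum.cong) (use fin in \<open>auto simp: lookup_basis_vector\<close>)
    moreover have "(\<Sum>B\<in>\<B>. (1 / card \<B>) * of_bool (e \<in> B)) > 0"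
      using \<open>finite \<B>\<close> \<open>B \<in> \<B>\<close> \<open>e \<in> B\<close> \<open>card \<B> > 0\<close> by (intro sum_pos2) auto
    ultimately show ?thesis by simp
  qed
  ultimately show "base_polytope M \<inter> positive_region (ground M) F (rank_in M F) \<noteq> {}"
    by (auto simp: positive_region_def)
next
  note finF = finite_subset[OF F is_matroidD(1)[OF M]]
  assume "base_polytope M \<inter> positive_region (ground M) F (rank_in M F) \<noteq> {}"
  then obtain y where y: "y \<in> base_polytope M" "rank_in M F \<le> (\<Sum>i\<in>F. Poly_Mapping.lookup y i)"
    and pos: "\<And>e. e \<in> ground M - F \<Longrightarrow> 0 < Poly_Mapping.lookup y e"
    by (auto simp: positive_region_def)
  obtain w :: "nat set \<Rightarrow> real" where w: "\<And>B. B \<in> bases M \<Longrightarrow> 0 \<le> w B" "sum w (bases M) = 1"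
    and lookup: "\<And>i. Poly_Mapping.lookup y i = (\<Sum>B\<in>bases M. w B * of_bool (i \<in> B))"
    and sumF: "(\<Sum>i\<in>F. Poly_Mapping.lookup y i) = (\<Sum>B\<in>bases M. w B * card (B \<inter> F))"
    by (rule base_polytopeE[OF M finF y(1)]) blast
  \<comment> \<open>The weighted defects are nonnegative while their sum is at most 0, so all
    vanish: only bases attaining the rank of \<open>F\<close> carry weight.\<close>
  have "(\<Sum>B\<in>bases M. w B * (rank_in M F - card (B \<inter> F))) \<le> 0"
    using y w sumF card_Int_le_rank_in[OF M]
    by (simp add: of_nat_diff right_diff_distrib sum_subtractf flip: sum_distrib_right)
  moreover have nonneg: "0 \<le> w B * (rank_in M F - card (B \<inter> F))" if "B \<in> bases M" for B
    using w that card_Int_le_rank_in[OF M that, of F] by simp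
  ultimately have "(\<Sum>B\<in>bases M. w B * (rank_in M F - card (B \<inter> F))) = 0"
    by (meson order_antisym sum_nonneg)
  then have tight: "w B * (rank_in M F - card (B \<inter> F)) = 0" if "B \<in> bases M" for B
    using nonneg that is_matroidD(3)[OF M] by (subst (asm) sum_nonneg_eq_0_iff) auto
  show "is_flat M F"
    unfolding is_flat_def
  proof (intro conjI ballI F)
    fix e assume e: "e \<in> ground M - F"
    \<comment> \<open>Positivity at \<open>e\<close> yields a base of nonzero weight through
      \<open>e\<close>. It attains the rank of \<open>F\<close>, and \<open>e\<close> adds one more
      element.\<close>
    have "(\<Sum>B\<in>bases M. w B * of_bool (e \<in> B)) \<noteq> 0"
      using pos[OF e] lookup[of e] by simp
    then obtain B where B: "B \<in> bases M" "w B * of_bool (e \<in> B) \<noteq> 0"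
      by (meson sum.neutral)
    then have "e \<in> B" "card (B \<inter> F) = rank_in M F"
      using tight[OF B(1)] card_Int_le_rank_in[OF M B(1), of F] by auto
    moreover have "card (B \<inter> insert e F) = Suc (card (B \<inter> F))"
      using \<open>e \<in> B\<close> e finF by simp
    ultimately show "rank_in M F < rank_in M (insert e F)"
      using card_Int_le_rank_in[OF M B(1), of "insert e F"] by simp
  qed
qed

lemma meets_positive_region_shift:
  assumes M: "is_matroid M" and "finite F" and rank: "rank_in M F > r"
    and meets: "base_polytope M \<inter> positive_region E F r \<noteq> {}"
  shows "base_polytope M \<inter> positive_region E F (r + 1/2) \<noteq> {}"
proof -
  obtain y where y: "y \<in> base_polytope M" "r \<le> (\<Sum>i\<in>F. Poly_Mapping.lookup y i)"
    and pos: "\<And>e. e \<in> E - F \<Longrightarrow> 0 < Poly_Mapping.lookup y e"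
    using meets by (auto simp: positive_region_def)
  obtain B where B: "B \<in> bases M" "card (B \<inter> F) = rank_in M F"
    using rank_in_attained[OF M] .
  note finB = is_matroidD(5)[OF M B(1)]
  \<comment> \<open>The midpoint has coordinate sum over \<open>F\<close> at least (r + (r + 1))/2 =
    r + 1/2, since the integer \<open>card (B \<inter> F)\<close> exceeds \<open>r\<close>. Halving
    \<open>y\<close> and adding nonnegative coordinates keeps positivity.\<close>
  define z where "z = (1/2) *\<^sub>R y + (1/2) *\<^sub>R basis_vector B"
  have "basis_vector B \<in> base_polytope M"
    using B by (auto simp: base_polytope_eq intro: hull_inc)
  then have "z \<in> base_polytope M"
    unfolding z_def using base_polytope_compact_convex(2)[OF M] y(1) by (intro convexD) auto
  have "(\<Sum>i\<in>F. Poly_Mapping.lookup z i) =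
      (1/2) * (\<Sum>i\<in>F. Poly_Mapping.lookup y i) + (1/2) * card (B \<inter> F)"
    by (simp add: z_def lookup_add lookup_scaleR sum.distrib sum_lookup_basis_vector
          finB \<open>finite F\<close> flip: sum_divide_distrib)
  then have "r + 1/2 \<le> (\<Sum>i\<in>F. Poly_Mapping.lookup z i)"
    using y(2) B(2) rank by simp
  moreover have "0 < Poly_Mapping.lookup z e" if "e \<in> E - F" for e
    using pos[OF that] by (simp add: z_def lookup_add lookup_scaleR lookup_basis_vector finB)
  ultimately show ?thesis
    using \<open>z \<in> base_polytope M\<close> by (auto simp: positive_region_def)
qed

text \<open>The shift 1/2 is out of reach when the rank is exactly \<open>r\<close>, but attainable
  from the first region when the rank is at least \<open>r + 1\<close>. So the two indicators cancel
  except at rank \<open>r\<close>, where the first one tests flatness.\<close>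

lemma flat_of_rank_indicator:
  assumes M: "is_matroid M" and F: "F \<subseteq> ground M"
  shows "of_bool (is_flat M F \<and> rank_in M F = r) =
    (of_bool (base_polytope M \<inter> positive_region (ground M) F r \<noteq> {}) -
     of_bool (base_polytope M \<inter> positive_region (ground M) F (r + 1/2) \<noteq> {}) :: int)"
proof -
  note finF = finite_subset[OF F is_matroidD(1)[OF M]]
  note bound = rank_in_ge_if_meets_positive_region[OF M finF]
  consider "rank_in M F < r" | "rank_in M F = r" | "rank_in M F > r" by linarith
  then show ?thesis
  proof cases
    case 1
    then have "base_polytope M \<inter> positive_region (ground M) F r = {}"
      "base_polytope M \<inter> positive_region (ground M) F (r + 1/2) = {}"
      using bound[of "ground M" r] bound[of "ground M" "r + 1/2"] by linarith+
    with 1 show ?thesis by simp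
  next
    case 2
    then have "base_polytope M \<inter> positive_region (ground M) F (r + 1/2) = {}"
      using bound[of "ground M" "r + 1/2"] by linarith
    with 2 is_flat_iff_meets_positive_region[OF M F] show ?thesis by simp
  next
    case 3
    have "positive_region (ground M) F (r + 1/2) \<subseteq> positive_region (ground M) F r"
      by (auto simp: positive_region_def)
    with meets_positive_region_shift[OF M finF 3, of "ground M"]
    have "base_polytope M \<inter> positive_region (ground M) F r \<noteq> {} \<longleftrightarrow>
        base_polytope M \<inter> positive_region (ground M) F (r + 1/2) \<noteq> {}"
      by blast
    with 3 show ?thesis by simp
  qed
qed

section \<open>Valuativity\<close>

lemma sum_meets_positive_region_eq_0:
  fixes a :: "'i \<Rightarrow> int"
  assumes "finite S" and M: "\<And>i. i \<in> S \<Longrightarrow> is_matroid (M i) \<and> ground (M i) = E"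
    and zero: "\<And>x. x \<in> coord_space E \<Longrightarrow>
      (\<Sum>i\<in>S. a i * of_bool (x \<in> base_polytope (M i))) = 0"
    and "finite E"
  shows "(\<Sum>i\<in>S. a i * of_bool (base_polytope (M i) \<inter> positive_region E F c \<noteq> {})) = 0"
proof -
  \<comment> \<open>Bounding the coordinates below by 1/(n + 1) replaces strict positivity by a
    closed condition.\<close>
  define C :: "nat \<Rightarrow> (nat, real) poly_mapping set" where
    "C n = {y. c \<le> (\<Sum>i\<in>F. Poly_Mapping.lookup y i)} \<inter>
           (\<Inter>e\<in>E - F. {y. 1 / Suc n \<le> Poly_Mapping.lookup y e})" for n
  have lin: "bounded_linear (\<lambda>y :: nat \<Rightarrow>\<^sub>0 real. Poly_Mapping.lookup y i)" for i
    by (rule bounded_linear_lookup)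
  have halfspace: "closed {y :: nat \<Rightarrow>\<^sub>0 real. b \<le> f y} \<and> convex {y. b \<le> f y}"
    if "bounded_linear f" for f and b :: real
    using that convex_linear_vimage[OF bounded_linear.linear[OF that], of "{b..}"]
    by (auto simp: vimage_def intro!: closed_Collect_le linear_continuous_on continuous_intros)
  have halfspace_sum: "closed {y :: nat \<Rightarrow>\<^sub>0 real. c \<le> (\<Sum>i\<in>F. Poly_Mapping.lookup y i)} \<and>
      convex {y. c \<le> (\<Sum>i\<in>F. Poly_Mapping.lookup y i)}"
    by (rule halfspace[OF bounded_linear_sum[OF lin]])
  have C: "closed (C n) \<and> convex (C n)" for n
    unfolding C_def using halfspace[OF lin] halfspace_sum
    by (auto intro!: closed_Int closed_INT convex_Int convex_INT)
  have "mono C"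
  proof (rule monoI)
    fix m n :: nat assume "m \<le> n"
    then have "1 / real (Suc n) \<le> 1 / real (Suc m)" by (simp add: frac_le)
    then show "C m \<subseteq> C n" by (force simp: C_def)
  qed
  have "(\<Union>n. C n) = positive_region E F c"
  proof (intro equalityI subsetI)
    fix y assume "y \<in> (\<Union>n. C n)"
    then obtain n where "y \<in> C n" by blast
    then have y: "c \<le> (\<Sum>i\<in>F. Poly_Mapping.lookup y i)"
      "\<And>e. e \<in> E - F \<Longrightarrow> 1 / Suc n \<le> Poly_Mapping.lookup y e"
      by (auto simp: C_def)
    have "0 < Poly_Mapping.lookup y e" if "e \<in> E - F" for e
      by (rule less_le_trans[OF _ y(2)[OF that]]) simp
    with y(1) show "y \<in> positive_region E F c"
      by (simp add: positive_region_def)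
  next
    fix y assume y: "y \<in> positive_region E F c"
    \<comment> \<open>Finitely many positive coordinates have a common positive lower bound 1/(n +
      1).\<close>
    have "eventually (\<lambda>n. \<forall>e\<in>E - F. 1 / Suc n < Poly_Mapping.lookup y e) sequentially"
      using y \<open>finite E\<close> LIMSEQ_Suc[OF lim_1_over_n]
      by (intro eventually_ball_finite) (auto simp: positive_region_def dest: order_tendstoD(2))
    then obtain n where "\<forall>e\<in>E - F. 1 / Suc n < Poly_Mapping.lookup y e"
      using eventually_happens'[OF sequentially_bot] by fast
    then have "y \<in> C n" using y by (auto simp: C_def positive_region_def less_imp_le)
    then show "y \<in> (\<Union>n. C n)" by blast
  qed
  moreover have "(\<Sum>i\<in>S. a i * of_bool (base_polytope (M i) \<inter> (\<Union>n. C n) \<noteq> {})) = 0"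
  proof (rule sum_meets_Union_eq_0[OF \<open>finite S\<close> \<open>finite E\<close> _ lin _ zero C \<open>mono C\<close>])
    show "compact (base_polytope (M i)) \<and> convex (base_polytope (M i)) \<and>
        base_polytope (M i) \<subseteq> coord_space E" if "i \<in> S" for i
      using M[OF that] base_polytope_compact_convex by blast
    show "x = y" if "x \<in> coord_space E" "y \<in> coord_space E"
      "\<And>e. e \<in> E \<Longrightarrow> Poly_Mapping.lookup x e = Poly_Mapping.lookup y e" for x y
      using that by (intro poly_mapping_eqI) (metis coord_space_def in_keys_iff mem_Collect_eq subsetD)
  qed
  ultimately show ?thesis by simp
qed

text \<open>Ranks never exceed the rank of the matroid, so cutting off the defining sum there loses
  no flats. The index set of the new sum depends only on the ground set, which allows interchanging
  it with a sum over matroids sharing that set.\<close>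

lemma coeff_whitney_poly:
  assumes M: "is_matroid M"
  shows "coeff (whitney_poly M) r =
    (\<Sum>F\<in>Pow (ground M). of_bool (is_flat M F \<and> rank_in M F = r))"
proof -
  have fin: "finite (Pow (ground M))" using is_matroidD(1)[OF M] by simp
  have eq: "{F. is_flat M F \<and> rank_in M F = r} =
      {F \<in> Pow (ground M). is_flat M F \<and> rank_in M F = r}"
    by (auto simp: is_flat_def)
  have "coeff (whitney_poly M) r = (if r \<le> matroid_rank M then int (whitney_second M r) else 0)"
    by (simp add: whitney_poly_def coeff_sum)
  also have "\<dots> = int (whitney_second M r)"
  proof -
    have "whitney_second M r = 0" if "\<not> r \<le> matroid_rank M"
    proof -
      have "{F. is_flat M F \<and> rank_in M F = r} = {}"
        using that rank_in_le_matroid_rank[OF M] by auto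
      then show ?thesis unfolding whitney_second_def by (metis card.empty)
    qed
    then show ?thesis by simp
  qed
  also have "\<dots> = (\<Sum>F\<in>Pow (ground M). of_bool (is_flat M F \<and> rank_in M F = r))"
    unfolding whitney_second_def eq using fin by (simp add: Int_def conj_commute)
  finally show ?thesis .
qed

lemma matroid_valuation_whitney_poly: "matroid_valuation whitney_poly"
  unfolding matroid_valuation_def
proof (intro allI impI)
  fix E s and M :: "nat \<Rightarrow> matroid" and a :: "nat \<Rightarrow> int"
  assume M: "\<forall>i\<in>{1..s}. is_matroid (M i) \<and> ground (M i) = E"
    and zero: "\<forall>x\<in>coord_space E. (\<Sum>i=1..s. a i * indicator (base_polytope (M i)) x) = 0"
  show "(\<Sum>i=1..s. int_multiple (a i) (whitney_poly (M i))) = 0"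
  \<comment> \<open>Finiteness of \<open>E\<close> comes from one of the matroids; for
    \<open>s = 0\<close> the sum is empty.\<close>
  proof (cases "s = 0")
    case False
    then have "finite E" using M is_matroidD(1) by force
    have region: "(\<Sum>i=1..s. a i * of_bool (base_polytope (M i) \<inter> positive_region E F c \<noteq> {})) = 0"
      for F c
      using M zero \<open>finite E\<close>
      by (intro sum_meets_positive_region_eq_0) (auto simp: indicator_def)
    have flat: "(\<Sum>i=1..s. a i * of_bool (is_flat (M i) F \<and> rank_in (M i) F = r)) = 0"
      if "F \<subseteq> E" for F r
    proof -
      have "a i * of_bool (is_flat (M i) F \<and> rank_in (M i) F = r) =
          a i * of_bool (base_polytope (M i) \<inter> positive_region E F r \<noteq> {}) -
          a i * of_bool (base_polytope (M i) \<inter> positive_region E F (r + 1/2) \<noteq> {})"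
        if "i \<in> {1..s}" for i
        using flat_of_rank_indicator[of "M i" F r] M that \<open>F \<subseteq> E\<close>
        by (simp only: right_diff_distrib)
      then have "(\<Sum>i=1..s. a i * of_bool (is_flat (M i) F \<and> rank_in (M i) F = r)) =
          (\<Sum>i=1..s. a i * of_bool (base_polytope (M i) \<inter> positive_region E F r \<noteq> {}) -
            a i * of_bool (base_polytope (M i) \<inter> positive_region E F (r + 1/2) \<noteq> {}))"
        by (rule sum.cong[OF refl])
      then show ?thesis
        by (simp only: sum_subtractf region diff_self)
    qed
    show ?thesis
    proof (rule poly_eqI)
      fix r
      have "coeff (\<Sum>i=1..s. int_multiple (a i) (whitney_poly (M i))) r =
          (\<Sum>i=1..s. a i * coeff (whitney_poly (M i)) r)"
        by (simp add: int_multiple_ring coeff_sum of_int_poly)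
      also have "\<dots> = (\<Sum>i=1..s. \<Sum>F\<in>Pow E. a i * of_bool (is_flat (M i) F \<and> rank_in (M i) F = r))"
        using M by (intro sum.cong) (auto simp: coeff_whitney_poly sum_distrib_left)
      \<comment> \<open>For each fixed \<open>F\<close> the inner sum vanishes by
        \<open>flat\<close>.\<close>
      also have "\<dots> = (\<Sum>F\<in>Pow E. \<Sum>i=1..s. a i * of_bool (is_flat (M i) F \<and> rank_in (M i) F = r))"
        by (rule sum.swap)
      also have "\<dots> = 0"
        using flat by (intro sum.neutral) auto
      finally show "coeff (\<Sum>i=1..s. int_multiple (a i) (whitney_poly (M i))) r = coeff 0 r"
        by simp
    qed
  qed simp
qed

section \<open>Invariance\<close>

text \<open>By the formula with \<open>card (B \<inter> F)\<close>, an isomorphism preserves ranks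
  of subsets, hence flats; taking images is a bijection between the subsets of the two ground
  sets.\<close>

lemma whitney_poly_iso:
  assumes M: "is_matroid M" and N: "is_matroid N" and "matroid_iso M N"
  shows "whitney_poly M = whitney_poly N"
proof -
  obtain \<phi> where \<phi>: "bij_betw \<phi> (ground M) (ground N)" and bN: "bases N = (\<lambda>B. \<phi> ` B) ` bases M"
    using assms(3) by (auto simp: matroid_iso_def)
  have inj: "inj_on \<phi> (ground M)" and img: "\<phi> ` ground M = ground N"
    using \<phi> by (auto simp: bij_betw_def)
  have rank: "rank_in N (\<phi> ` F) = rank_in M F" if "F \<subseteq> ground M" for F
  proof -
    have "card (\<phi> ` B \<inter> \<phi> ` F) = card (B \<inter> F)" if "B \<in> bases M" for B
    proof -
      have "B \<subseteq> ground M" using is_matroidD(4)[OF M that] .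
      then have "\<phi> ` B \<inter> \<phi> ` F = \<phi> ` (B \<inter> F)"
        using inj_on_image_Int[OF inj] \<open>F \<subseteq> ground M\<close> by simp
      then show ?thesis
        using \<open>B \<subseteq> ground M\<close> by (metis card_image inf.coboundedI1 inj inj_on_subset)
    qed
    then have "(\<lambda>B. card (B \<inter> \<phi> ` F)) ` bases N = (\<lambda>B. card (B \<inter> F)) ` bases M"
      by (simp add: bN image_image)
    then show ?thesis by (simp add: rank_in_eq_Max_card_Int M N)
  qed
  have flat: "is_flat N (\<phi> ` F) \<longleftrightarrow> is_flat M F" if F: "F \<subseteq> ground M" for F
  proof -
    have "ground N - \<phi> ` F = \<phi> ` (ground M - F)"
      using inj_on_image_set_diff[OF inj, of "ground M" F] F img by auto
    moreover have "rank_in N (insert (\<phi> e) (\<phi> ` F)) = rank_in M (insert e F)"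
      if "e \<in> ground M - F" for e
      using rank[of "insert e F"] that F by simp
    moreover have "\<phi> ` F \<subseteq> ground N"
      using F img by blast
    ultimately show ?thesis
      using F rank[OF F] by (simp add: is_flat_def)
  qed
  have bij: "bij_betw ((`) \<phi>) (Pow (ground M)) (Pow (ground N))"
    using \<phi> by (rule bij_betw_Pow)
  show ?thesis
  proof (rule poly_eqI)
    fix r
    show "coeff (whitney_poly M) r = coeff (whitney_poly N) r"
      unfolding coeff_whitney_poly[OF M] coeff_whitney_poly[OF N]
        sum.reindex_bij_betw[OF bij, symmetric]
      by (rule sum.cong) (auto simp: flat rank)
  qed
qed

theorem corollary8p4:
  shows "valuative_invariant whitney_poly"
  unfolding valuative_invariant_def
  using matroid_valuation_whitney_poly whitney_poly_iso by blast

end
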